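(* Let $F_{r,n}$ be the number of fixed points of the permutation obtained after $r$ iterated random-to-top shuffles of an $n$-card deck, starting from the identity. (i) Let $c>0$ be a constant. Then, as $n\to\infty$, $F_{\lfloor cn\rfloor,n}$ converges in distribution to $X+Y$, where $X$ and $Y$ are independent, $X$ is Poisson with mean $1-e^{-c}$, and $Y$ is geometric with parameter $1-e^{-c}$, i.e. $\mathbb{P}(Y=k)=(1-e^{-c})e^{-ck}$ for all integers $k\ge 0$. (ii) If $r=r(n)$ is a sequence of positive integers with $r(n)/n\to\infty$ as $n\to\infty$, then $F_{r(n),n}$ converges in distribution to a Poisson random variable with mean $1$.
   Context: A deck of $n$ cards labelled $1,\dots,n$ in some order is encoded by the permutation $\pi$ of $[n]=\{1,\dots,n\}$ where $\pi(i)$ is the card in position $i$ (position $1$ is the top). A random-to-top shuffle selects one of the $n$ cards uniformly at random (the top card may be selected) and moves it to the top, keeping the relative order of the other cards. Iterated random-to-top shuffles start from the deck in order $12\cdots n$ and perform the selections independently. A fixed point of $\pi$ is an index $i\in[n]$ with $\pi(i)=i$. *)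

theory Defs
  imports "HOL-Probability.Probability"
begin

text \<open>A deck is the list of its cards from top to bottom, with cards labelled \<open>1, \<dots>, n\<close>.
  The permutation encoding it sends the position \<open>i\<close> (counted from 1) to the card there;
  it is only meaningful for \<open>i \<in> {1..length xs}\<close>.\<close>

definition deck_perm :: "nat list \<Rightarrow> nat \<Rightarrow> nat" where
  "deck_perm xs i = xs ! (i - 1)"

definition num_fixed_points :: "nat list \<Rightarrow> nat" where
  "num_fixed_points xs = card {i \<in> {1..length xs}. deck_perm xs i = i}"

definition move_to_top :: "nat \<Rightarrow> nat list \<Rightarrow> nat list" where
  "move_to_top c xs = c # remove1 c xs"

definition random_to_top :: "nat \<Rightarrow> nat list \<Rightarrow> nat list pmf" where
  "random_to_top n xs = map_pmf (\<lambda>c. move_to_top c xs) (pmf_of_set {1..n})"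

text \<open>The law of the deck after \<open>r\<close> shuffles. It is meaningful for \<open>n \<ge> 1\<close> only, since
  \<^const>\<open>pmf_of_set\<close> is unspecified on the empty set.\<close>

primrec iterated_random_to_top :: "nat \<Rightarrow> nat \<Rightarrow> nat list pmf" where
  "iterated_random_to_top n 0 = return_pmf [1..<Suc n]"
| "iterated_random_to_top n (Suc r) = bind_pmf (iterated_random_to_top n r) (random_to_top n)"

definition fixed_points_pmf :: "nat \<Rightarrow> nat \<Rightarrow> nat pmf" where
  "fixed_points_pmf r n = map_pmf num_fixed_points (iterated_random_to_top n r)"

definition real_law :: "nat pmf \<Rightarrow> real measure" where
  "real_law p = distr (measure_pmf p) borel real"

definition conv_in_distribution :: "(nat \<Rightarrow> nat pmf) \<Rightarrow> nat pmf \<Rightarrow> bool" where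
  "conv_in_distribution P p \<longleftrightarrow> weak_conv_m (\<lambda>n. real_law (P n)) (real_law p)"

end

theory Submission
  imports Defs "HOL-Real_Asymp.Real_Asymp"
begin

text \<open>Call a card touched if it has been selected. Given that \<open>k\<close> cards have been touched, the top of
  the deck is a uniformly random list of \<open>k\<close> distinct cards, and the untouched cards follow in
  increasing order. A fixed point below position \<open>k\<close> is a card larger than every touched card, so
  the number of fixed points is \<open>X + Y\<close>, where \<open>X\<close> counts the matches among the first \<open>k\<close> positions
  and \<open>Y\<close> is the gap between \<open>n\<close> and the largest touched card. Double counting gives
  \<open>E[binom(X, m); Y \<ge> j]\<close> in closed form, with limit \<open>\<rho>^m / m! * (1 - \<rho>)^j\<close> when \<open>k / n \<longlonglongrightarrow> \<rho>\<close>;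
  inclusion-exclusion and dominated convergence turn this into independent Poisson and geometric
  limits. Finally \<open>k / n\<close> converges to \<open>\<rho>\<close> in mean square, where \<open>\<rho> = 1 - exp (- c)\<close> in part (i)
  and \<open>\<rho> = 1\<close> in part (ii), in which case the geometric part vanishes.\<close>

section \<open>Random lists of distinct cards\<close>

definition distinct_lists :: "'a set \<Rightarrow> nat \<Rightarrow> 'a list set" where
  "distinct_lists A k = {xs. length xs = k \<and> distinct xs \<and> set xs \<subseteq> A}"

lemma finite_distinct_lists [simp]:
  assumes "finite A"
  shows "finite (distinct_lists A k)"
proof -
  have "distinct_lists A k \<subseteq> {xs. set xs \<subseteq> A \<and> length xs = k}"
    by (auto simp: distinct_lists_def)
  then show ?thesis
    using finite_lists_length_eq[OF assms] finite_subset by blast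
qed

text \<open>The list is built from its head: a constrained head is forced, a free head must avoid
  the values reserved for later positions, and either way the tail poses the same problem over one
  element fewer. The quotient of factorials is multiplied out to stay within the naturals.\<close>

lemma card_distinct_lists_prescribed:
  assumes "finite A" "k \<le> card A" "I \<subseteq> {..<k}" "inj_on f I" "f ` I \<subseteq> A"
  shows "card {xs \<in> distinct_lists A k. \<forall>i\<in>I. xs ! i = f i} * fact (card A - k)
           = (fact (card A - card I) :: nat)"
  using assms
proof (induction k arbitrary: A I f)
  case 0
  then have "{xs \<in> distinct_lists A 0. \<forall>i\<in>I. xs ! i = f i} = {[]}" "I = {}"
    by (auto simp: distinct_lists_def)
  then show ?case by simp
next
  case (Suc k)
  let ?S = "\<lambda>A k I f. {xs \<in> distinct_lists A k. \<forall>i\<in>I. xs ! i = f i}"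
  \<comment> \<open>\<open>J\<close> holds the constrained positions of the tail, shifted down by
    one; \<open>C\<close> holds the admissible heads.\<close>
  define J where "J = {i. Suc i \<in> I}"
  define C where "C = (if 0 \<in> I then {f 0} else A - f ` I)"
  have finI: "finite I" using Suc.prems(3) finite_subset by blast
  have C: "C \<subseteq> A" "finite C" using Suc.prems by (auto simp: C_def intro: finite_subset)
  have fresh: "(f \<circ> Suc) ` J \<subseteq> A - {c}" if "c \<in> C" for c
    using that Suc.prems(4,5) by (auto simp: C_def J_def inj_on_def split: if_splits)
  have I_eq: "I = (if 0 \<in> I then insert 0 (Suc ` J) else Suc ` J)"
  proof (rule set_eqI)
    fix i show "i \<in> I \<longleftrightarrow> i \<in> (if 0 \<in> I then insert 0 (Suc ` J) else Suc ` J)"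
      by (cases i) (simp_all add: J_def image_iff)
  qed
  have finJ: "finite J"
    using finI by (simp add: J_def finite_vimageI[of I Suc, unfolded vimage_def])
  have cardI: "card I = (if 0 \<in> I then Suc (card J) else card J)"
    by (subst I_eq) (use finJ in \<open>simp add: card_image\<close>)
  have split: "?S A (Suc k) I f = (\<Union>c\<in>C. (#) c ` ?S (A - {c}) k J (f \<circ> Suc))"
    (is "?L = ?R")
  proof (intro equalityI subsetI)
    fix xs assume xs: "xs \<in> ?L"
    then obtain c ys where cy: "xs = c # ys" "length ys = k" "c \<notin> set ys" "distinct ys"
        "c \<in> A" "set ys \<subseteq> A"
      by (auto simp: distinct_lists_def length_Suc_conv)
    have ys: "ys ! i = f (Suc i)" if "i \<in> J" for i
      using that xs cy by (auto simp: J_def)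
    have "c \<in> C"
    proof (cases "0 \<in> I")
      case True
      then show ?thesis using xs cy by (auto simp: C_def)
    next
      case False
      have "c \<noteq> f i" if "i \<in> I" for i
      proof -
        obtain i' where "i = Suc i'" using \<open>i \<in> I\<close> False by (cases i) auto
        then have "i' \<in> J" "i' < k" using \<open>i \<in> I\<close> Suc.prems(3) by (auto simp: J_def)
        then have "f i \<in> set ys" using ys \<open>i = Suc i'\<close> cy(2) nth_mem by metis
        then show ?thesis using cy(3) by auto
      qed
      then show ?thesis using cy(5) False by (auto simp: C_def)
    qed
    then show "xs \<in> ?R"
      using cy ys by (auto simp: distinct_lists_def)
  next
    fix xs assume "xs \<in> ?R"
    then obtain c ys where cy: "c \<in> C" "xs = c # ys" "ys \<in> ?S (A - {c}) k J (f \<circ> Suc)"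
      by auto
    have "xs ! i = f i" if "i \<in> I" for i
      using that cy by (cases i) (auto simp: J_def C_def)
    then show "xs \<in> ?L"
      using cy C by (auto simp: distinct_lists_def)
  qed
  have "card (?S A (Suc k) I f) = (\<Sum>c\<in>C. card (?S (A - {c}) k J (f \<circ> Suc)))"
    unfolding split using C(2) Suc.prems(1)
    by (subst card_UN_disjoint) (auto simp: card_image)
  also have "\<dots> * fact (card A - Suc k) = (\<Sum>c\<in>C. fact (card A - 1 - card J))"
    unfolding sum_distrib_right
  proof (rule sum.cong)
    fix c assume c: "c \<in> C"
    then have cA: "card (A - {c}) = card A - 1" using C Suc.prems(1) by auto
    have "inj_on (f \<circ> Suc) J"
      using Suc.prems(4) by (auto simp: inj_on_def J_def)
    then have "card (?S (A - {c}) k J (f \<circ> Suc)) * fact (card (A - {c}) - k)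
            = (fact (card (A - {c}) - card J) :: nat)"
      using Suc.prems fresh[OF c] cA by (intro Suc.IH) (auto simp: J_def comp_def)
    then show "card (?S (A - {c}) k J (f \<circ> Suc)) * fact (card A - Suc k)
            = fact (card A - 1 - card J)"
      using cA by simp
  qed simp
  also have "\<dots> = card C * fact (card A - 1 - card J)" by simp
  also have "\<dots> = fact (card A - card I)"
  proof (cases "0 \<in> I")
    case True
    then show ?thesis using cardI by (simp add: C_def)
  next
    case False
    \<comment> \<open>Hence \<open>card I < card A\<close>, so the factor
      \<open>card A - card I\<close> contributed by the head is positive and completes the smaller
      factorial.\<close>
    have "card J \<le> k"
      using Suc.prems(3) card_mono[of "{..<k}" J] by (auto simp: J_def)
    moreover have "card C = card A - card I"
      using False Suc.prems finI by (simp add: C_def card_Diff_subset card_image)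
    ultimately show ?thesis
      using False cardI Suc.prems(2) fact_reduce[of "card A - card I", where 'a=nat] by simp
  qed
  finally show ?case .
qed

lemma card_distinct_lists:
  assumes "finite A" "k \<le> card A"
  shows "card (distinct_lists A k) * fact (card A - k) = (fact (card A) :: nat)"
  using card_distinct_lists_prescribed[OF assms, where I="{}" and f="\<lambda>_. undefined"] by simp

section \<open>Matches and gap of a random list of touched cards\<close>

definition matches :: "nat list \<Rightarrow> nat" where
  "matches xs = card {i. i < length xs \<and> xs ! i = Suc i}"

text \<open>The inserted 0 keeps \<open>Max\<close> meaningful for the empty list, whose gap is then
  \<open>n\<close>.\<close>

definition gap :: "nat \<Rightarrow> nat list \<Rightarrow> nat" where
  "gap n xs = n - Max (insert 0 (set xs))"

lemma matches_le_length: "matches xs \<le> length xs"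
proof -
  have "matches xs \<le> card {..<length xs}"
    unfolding matches_def by (rule card_mono) auto
  then show ?thesis by simp
qed

text \<open>Double counting of the pairs of a list and an \<open>m\<close>-set of positions at which it matches.\<close>
lemma sum_matches_choose:
  assumes "k \<le> N"
  shows "(\<Sum>xs\<in>distinct_lists {1..N} k. matches xs choose m) * fact (N - k)
           = (k choose m) * fact (N - m)"
proof -
  let ?L = "distinct_lists {1..N} k"
  let ?P = "{I. I \<subseteq> {..<k} \<and> card I = m}"
  have "matches xs choose m = (\<Sum>I\<in>?P. if \<forall>i\<in>I. xs ! i = Suc i then 1 else 0)"
    if "xs \<in> ?L" for xs
  proof -
    have len: "length xs = k" using that by (simp add: distinct_lists_def)
    have "matches xs choose m = card {I. I \<subseteq> {i. i < length xs \<and> xs ! i = Suc i} \<and> card I = m}"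
      unfolding matches_def by (rule n_subsets[symmetric]) simp
    also have "{I. I \<subseteq> {i. i < length xs \<and> xs ! i = Suc i} \<and> card I = m}
                 = {I \<in> ?P. \<forall>i\<in>I. xs ! i = Suc i}"
      using len by auto
    finally show ?thesis by (simp add: sum.If_cases Int_def)
  qed
  then have "(\<Sum>xs\<in>?L. matches xs choose m)
      = (\<Sum>xs\<in>?L. \<Sum>I\<in>?P. if \<forall>i\<in>I. xs ! i = Suc i then 1 else 0)"
    by simp
  also have "\<dots> = (\<Sum>I\<in>?P. \<Sum>xs\<in>?L. if \<forall>i\<in>I. xs ! i = Suc i then 1 else 0)"
    by (rule sum.swap)
  also have "\<dots> = (\<Sum>I\<in>?P. card {xs\<in>?L. \<forall>i\<in>I. xs ! i = Suc i})"
    by (simp add: sum.If_cases Int_def)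
  also have "\<dots> * fact (N - k) = (\<Sum>I\<in>?P. fact (N - m))"
    unfolding sum_distrib_right
  proof (rule sum.cong)
    fix I assume I: "I \<in> ?P"
    then have "Suc ` I \<subseteq> {1..N}" using assms by fastforce
    then show "card {xs\<in>?L. \<forall>i\<in>I. xs ! i = Suc i} * fact (N - k) = fact (N - m)"
      using card_distinct_lists_prescribed[of "{1..N}" k I Suc] assms I by simp
  qed simp
  also have "\<dots> = (k choose m) * fact (N - m)"
    by (simp add: n_subsets)
  finally show ?thesis .
qed

text \<open>A lower bound on the gap merely shrinks the alphabet to \<open>n - j\<close> cards, so
  such lists can be counted like unrestricted ones. The bound \<open>j \<le> n\<close> matters for
  the empty list: for larger \<open>j\<close> the right side would hold and the left side
  fail.\<close>

lemma gap_ge_iff: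
  assumes "set xs \<subseteq> {1..n}" "j \<le> n"
  shows "j \<le> gap n xs \<longleftrightarrow> set xs \<subseteq> {1..n - j}"
proof -
  have "j \<le> gap n xs \<longleftrightarrow> Max (insert 0 (set xs)) \<le> n - j"
  proof -
    have "Max (insert 0 (set xs)) \<le> n" using assms(1) by auto
    then show ?thesis unfolding gap_def using assms(2) by linarith
  qed
  also have "\<dots> \<longleftrightarrow> set xs \<subseteq> {1..n - j}"
    using assms(1) by fastforce
  finally show ?thesis .
qed

text \<open>The expectation of \<open>matches choose m\<close> on the event \<open>gap \<ge> j\<close>, given \<open>k\<close> touched cards. If \<open>m + j > n\<close>,
  the denominator vanishes and division by zero gives the correct value 0.\<close>
definition joint_moment :: "nat \<Rightarrow> nat \<Rightarrow> nat \<Rightarrow> nat \<Rightarrow> real" where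
  "joint_moment n k m j =
     real (k choose m) * real (n - k choose j) * fact j / (real (n choose (m + j)) * fact (m + j))"

text \<open>In the main case the lists are the distinct lists over \<open>{1..n - j}\<close>, so the
  double count applies with \<open>n - j\<close> in place of \<open>N\<close>; regrouping factorials
  into binomials gives the closed form.\<close>

lemma sum_matches_choose_gap:
  assumes "k \<le> n"
  shows "real (\<Sum>xs\<in>{xs \<in> distinct_lists {1..n} k. j \<le> gap n xs}. matches xs choose m)
           / real (card (distinct_lists {1..n} k)) = joint_moment n k m j"
proof -
  let ?T = "{xs \<in> distinct_lists {1..n} k. j \<le> gap n xs}"
  have L: "real (card (distinct_lists {1..n} k)) = fact n / fact (n - k)"
  proof -
    have "real (card (distinct_lists {1..n} k) * fact (n - k)) = real (fact n)"
      using card_distinct_lists[of "{1..n}" k] assms by simp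
    then show ?thesis by (simp add: field_simps)
  qed
  show ?thesis
  proof (cases "m \<le> k \<and> j \<le> n - k")
    case True
    have "?T = distinct_lists {1..n - j} k"
      using gap_ge_iff[of _ n j] True assms by (fastforce simp: distinct_lists_def)
    moreover have "k \<le> n - j" using True assms by linarith
    ultimately have "(\<Sum>xs\<in>?T. matches xs choose m) * fact (n - j - k)
        = (k choose m) * fact (n - j - m)"
      using sum_matches_choose[of k "n - j" m] by simp
    then have "real ((\<Sum>xs\<in>?T. matches xs choose m) * fact (n - j - k))
        = real ((k choose m) * fact (n - j - m))"
      by (rule arg_cong)
    then have "real (\<Sum>xs\<in>?T. matches xs choose m) * fact (n - j - k)
        = real (k choose m) * fact (n - j - m)"
      by (simp only: of_nat_mult of_nat_fact)
    then have S: "real (\<Sum>xs\<in>?T. matches xs choose m)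
        = real (k choose m) * fact (n - j - m) / fact (n - j - k)"
      by (simp add: field_simps del: of_nat_sum)
    have B1: "real (n choose (m + j)) = fact n / (fact (m + j) * fact (n - j - m))"
      using True assms by (subst binomial_fact) (auto simp: algebra_simps)
    have B2: "real (n - k choose j) = fact (n - k) / (fact j * fact (n - j - k))"
      using True assms by (subst binomial_fact) (auto simp: add.commute)
    show ?thesis
      unfolding L joint_moment_def S B1 B2 by (simp add: field_simps)
  next
    case False
    \<comment> \<open>The closed form has a zero binomial here. Either \<open>m > k\<close> exceeds
      the possible number of matches, or \<open>j > n - k\<close> and \<open>k\<close> distinct
      cards do not fit into \<open>{1..n - j}\<close>, so that no list is left.\<close>
    have "matches xs choose m = 0" if "xs \<in> ?T" for xs
    proof (cases "m \<le> k")
      case True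
      then have jk: "n - k < j" using False by simp
      have xs: "length xs = k" "distinct xs" "set xs \<subseteq> {1..n}" "j \<le> gap n xs"
        using that by (auto simp: distinct_lists_def)
      have "j \<le> n" using xs(4) by (simp add: gap_def)
      then have "set xs \<subseteq> {1..n - j}" using gap_ge_iff xs by blast
      then have "k \<le> n - j"
        using xs card_mono[of "{1..n - j}" "set xs"] distinct_card[of xs] by simp
      then have "k = 0" using jk assms \<open>j \<le> n\<close> by linarith
      then show ?thesis using jk \<open>j \<le> n\<close> by simp
    next
      case False
      then show ?thesis using that matches_le_length[of xs]
        by (auto simp: distinct_lists_def)
    qed
    then have Z: "(\<Sum>xs\<in>?T. matches xs choose m) = 0" by simp
    show ?thesis
      unfolding Z using False by (auto simp: joint_moment_def)
  qed
qed

lemma joint_moment_nonneg: "0 \<le> joint_moment n k m j"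
  by (simp add: joint_moment_def)

text \<open>By Vandermonde, the product of the two binomials is one term of a sum equal to
  \<open>n choose (m + j)\<close>, and m! j! divides (m + j)!. The bound is free of
  \<open>n\<close>, \<open>k\<close> and \<open>j\<close>, which makes it a dominating
  sequence.\<close>

lemma joint_moment_le:
  assumes "k \<le> n"
  shows "joint_moment n k m j \<le> 1 / fact m"
proof -
  have "(k choose m) * (n - k choose j) = (k choose m) * (n - k choose ((m + j) - m))" by simp
  also have "\<dots> \<le> (\<Sum>i\<le>m + j. (k choose i) * (n - k choose ((m + j) - i)))"
    by (rule member_le_sum[where i=m and f="\<lambda>i. (k choose i) * (n - k choose ((m + j) - i))"]) auto
  also have "\<dots> = n choose (m + j)"
    using vandermonde[where m=k and n="n-k" and r="m+j"] assms by simp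
  finally have le: "real (k choose m) * real (n - k choose j) \<le> real (n choose (m + j))"
    by (metis of_nat_le_iff of_nat_mult)
  have "real (fact m * fact j) \<le> real (fact (m + j))"
    unfolding of_nat_le_iff by (intro dvd_imp_le fact_fact_dvd_fact) auto
  then have fact: "fact m * fact j \<le> (fact (m + j) :: real)" by simp
  show ?thesis
  proof (cases "(n choose (m + j)) = 0")
    case False
    have "joint_moment n k m j \<le> real (n choose (m + j)) * fact j / (real (n choose (m + j)) * fact (m + j))"
      unfolding joint_moment_def by (intro divide_right_mono mult_right_mono le) auto
    also have "\<dots> = fact j / fact (m + j)" using False by simp
    also have "\<dots> \<le> 1 / fact m" using fact by (simp add: field_simps)
    finally show ?thesis .
  qed (simp add: joint_moment_def binomial_eq_0)
qed

section \<open>Fixed points and shuffling of a deck with touched cards on top\<close>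

text \<open>\<open>xs\<close> lists the touched cards, the most recently selected first.\<close>

definition deck :: "nat \<Rightarrow> nat list \<Rightarrow> nat list" where
  "deck n xs = xs @ filter (\<lambda>c. c \<notin> set xs) [1..<Suc n]"

lemma num_fixed_points_eq_matches: "num_fixed_points xs = matches xs"
proof -
  have "{i \<in> {1..length xs}. deck_perm xs i = i} = Suc ` {i. i < length xs \<and> xs ! i = Suc i}"
    (is "?A = ?B")
  proof (rule set_eqI)
    fix i show "i \<in> ?A \<longleftrightarrow> i \<in> ?B"
      by (cases i) (auto simp: deck_perm_def)
  qed
  then show ?thesis
    by (simp add: num_fixed_points_def matches_def card_image)
qed

text \<open>After index \<open>p\<close> there remain \<open>length ys - Suc p\<close> entries, each
  larger than its predecessor by at least one and none above \<open>b\<close>.\<close>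

lemma sorted_wrt_less_nth_le:
  fixes ys :: "nat list"
  assumes "sorted_wrt (<) ys" "\<forall>y\<in>set ys. y \<le> b" "p < length ys"
  shows "ys ! p + length ys \<le> b + Suc p"
  using assms
proof (induction ys arbitrary: p)
  case (Cons y ys)
  show ?case
  proof (cases p)
    case 0
    show ?thesis
    proof (cases ys)
      case Nil
      then show ?thesis using Cons.prems 0 by simp
    next
      case (Cons z zs)
      then have "ys ! 0 + length ys \<le> b + Suc 0" using Cons.IH[of 0] Cons.prems by simp
      moreover have "y < ys ! 0" using Cons.prems(1) Cons by simp
      ultimately show ?thesis using 0 by simp
    qed
  next
    case (Suc q)
    then show ?thesis using Cons.IH[of q] Cons.prems by simp
  qed
qed simp

text \<open>An untouched card \<open>i\<close> sits at position \<open>i\<close> iff all touched cards are smaller than \<open>i\<close>.\<close>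
lemma num_fixed_points_deck:
  assumes xs: "xs \<in> distinct_lists {1..n} k"
  shows "num_fixed_points (deck n xs) = matches xs + gap n xs"
proof -
  \<comment> \<open>\<open>M\<close> is the largest touched card, or 0 if there is none.\<close>
  define M where "M = Max (insert 0 (set xs))"
  define ys where "ys = filter (\<lambda>c. c \<notin> set xs) [1..<Suc M]"
  have len: "length xs = k" and sub: "set xs \<subseteq> {1..n}" and dist: "distinct xs"
    using xs by (auto simp: distinct_lists_def)
  have Mn: "M \<le> n" unfolding M_def using sub by auto
  have subM: "set xs \<subseteq> {1..M}" unfolding M_def using sub by auto
  have kM: "k \<le> M"
    using card_mono[OF _ subM] distinct_card[OF dist] len by simp
  have M_in: "M \<in> set xs" if "M > 0"
    using Max_in[of "insert 0 (set xs)"] that unfolding M_def by auto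
  have len_ys: "length ys = M - k"
  proof -
    have "distinct ys" by (simp add: ys_def del: upt_Suc)
    then have "length ys = card (set ys)" by (rule distinct_card [symmetric])
    also have "set ys = {1..M} - set xs" by (auto simp: ys_def)
    also have "card \<dots> = M - k"
      using subM distinct_card[OF dist] len by (simp add: card_Diff_subset)
    finally show ?thesis .
  qed
  \<comment> \<open>No card above \<open>M\<close> is touched, so the deck splits into the touched
    cards, the untouched cards below \<open>M\<close>, and the cards above \<open>M\<close> in their
    original positions.\<close>
  have "[1..<Suc n] = [1..<Suc M] @ [Suc M..<Suc n]"
    using upt_add_eq_append[of 1 "Suc M" "n - M"] Mn by simp
  moreover have "filter (\<lambda>c. c \<notin> set xs) [Suc M..<Suc n] = [Suc M..<Suc n]"
    using subM by (intro filter_True) auto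
  ultimately have deck: "deck n xs = xs @ ys @ [Suc M..<Suc n]"
    by (simp add: deck_def ys_def del: upt_Suc)
  have len_deck: "length (deck n xs) = n"
    unfolding deck using len len_ys kM Mn by simp
  \<comment> \<open>As \<open>M\<close> itself is touched, all of \<open>ys\<close> is at most
    \<open>M - 1\<close>. The card at index \<open>k + p\<close> is therefore too small to be the
    \<open>Suc (k + p)\<close> that a fixed point requires.\<close>
  have ys_le: "ys ! p \<le> k + p" if "p < M - k" for p
  proof -
    have "\<forall>y\<in>set ys. y \<le> M - 1"
      using M_in that by (fastforce simp: ys_def)
    moreover have "sorted_wrt (<) ys"
      unfolding ys_def by (intro sorted_wrt_filter sorted_wrt_upt)
    ultimately have "ys ! p + length ys \<le> M - 1 + Suc p"
      using that len_ys by (intro sorted_wrt_less_nth_le) auto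
    then show ?thesis using that len_ys by simp
  qed
  have "{i. i < length (deck n xs) \<and> deck n xs ! i = Suc i}
      = {i. i < length xs \<and> xs ! i = Suc i} \<union> {M..<n}" (is "?A = ?B")
  proof (rule set_eqI)
    fix i
    consider "i < k" | "k \<le> i" "i < M" | "M \<le> i" "i < n" | "n \<le> i" by linarith
    then show "i \<in> ?A \<longleftrightarrow> i \<in> ?B"
    proof cases
      case 1
      then show ?thesis using len len_deck kM Mn by (auto simp: deck nth_append)
    next
      case 2
      then have "deck n xs ! i = ys ! (i - k)"
        using len len_ys by (auto simp: deck nth_append)
      also have "\<dots> \<le> i" using ys_le[of "i - k"] 2 by simp
      finally show ?thesis using 2 len len_deck by auto
    next
      case 3
      then have "deck n xs ! i = Suc i"
        using len len_ys kM by (auto simp: deck nth_append simp del: upt_Suc)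
      then show ?thesis using 3 len_deck by auto
    next
      case 4
      then show ?thesis using len len_deck kM Mn by auto
    qed
  qed
  then have "matches (deck n xs) = card ({i. i < length xs \<and> xs ! i = Suc i} \<union> {M..<n})"
    by (simp add: matches_def)
  also have "\<dots> = matches xs + (n - M)"
    unfolding matches_def using len kM by (subst card_Un_disjoint) auto
  finally show ?thesis
    by (simp add: num_fixed_points_eq_matches gap_def M_def)
qed

section \<open>The effect of one shuffle on the list of touched cards\<close>

text \<open>A shuffle thus acts on the list of touched cards alone. Selecting a touched card leaves
  the untouched block as it is; selecting an untouched one deletes it from that block.\<close>

lemma move_to_top_deck:
  assumes "set xs \<subseteq> {1..n}" "c \<in> {1..n}"
  shows "move_to_top c (deck n xs) = deck n (c # remove1 c xs)"
proof (cases "c \<in> set xs")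
  case True
  have mem: "(\<lambda>d. d \<notin> set (c # remove1 c xs)) = (\<lambda>d. d \<notin> set xs)"
    using True by (auto simp: fun_eq_iff dest: notin_set_remove1)
  show ?thesis
    unfolding deck_def move_to_top_def mem using True by (simp add: remove1_append)
next
  case False
  have "remove1 c (filter (\<lambda>d. d \<notin> set xs) [1..<Suc n])
      = filter (\<lambda>d. d \<noteq> c \<and> d \<notin> set xs) [1..<Suc n]"
    by (subst distinct_remove1_removeAll)
      (auto simp: removeAll_filter_not_eq filter_filter intro!: filter_cong simp del: upt_Suc)
  then show ?thesis
    unfolding deck_def move_to_top_def using False by (simp add: remove1_append remove1_idem del: upt_Suc)
qed

lemma card_distinct_lists_Suc:
  assumes "k < n"
  shows "card (distinct_lists {1..n} (Suc k)) = (n - k) * card (distinct_lists {1..n} k)"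
proof -
  have "card (distinct_lists {1..n} (Suc k)) * fact (n - Suc k) = (fact n :: nat)"
    "card (distinct_lists {1..n} k) * fact (n - k) = (fact n :: nat)"
    using card_distinct_lists[of "{1..n}"] assms by auto
  moreover have "fact (n - k) = (n - k) * (fact (n - Suc k) :: nat)"
    using assms fact_reduce[of "n - k", where 'a=nat] by simp
  ultimately have "card (distinct_lists {1..n} (Suc k)) * fact (n - Suc k)
      = ((n - k) * card (distinct_lists {1..n} k)) * (fact (n - Suc k) :: nat)"
    by (simp add: mult_ac)
  then show ?thesis by simp
qed

lemma card_distinct_lists_pos:
  assumes "k \<le> n"
  shows "card (distinct_lists {1..n} k) > 0"
  using card_distinct_lists[of "{1..n}" k] assms by (cases "card (distinct_lists {1..n} k)") auto

text \<open>The preimages arise by inserting \<open>c\<close> at one of the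
  \<open>length zs + 1\<close> places; they differ because \<open>c\<close> does not occur in
  \<open>zs\<close>.\<close>

lemma card_remove1_preimage:
  assumes "distinct (c # zs)"
  shows "card {xs. distinct xs \<and> c \<in> set xs \<and> remove1 c xs = zs} = Suc (length zs)"
proof -
  let ?ins = "\<lambda>i. take i zs @ c # drop i zs"
  have "{xs. distinct xs \<and> c \<in> set xs \<and> remove1 c xs = zs} = ?ins ` {..length zs}" (is "?A = ?B")
  proof (intro equalityI subsetI)
    fix xs assume "xs \<in> ?A"
    then obtain us vs where "xs = us @ c # vs" "c \<notin> set us" "us @ vs = zs"
      by (auto simp: remove1_append dest!: split_list_first)
    then show "xs \<in> ?B" by (intro image_eqI[of _ _ "length us"]) auto
  next
    fix xs assume "xs \<in> ?B"
    then obtain i where i: "xs = ?ins i" by auto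
    have "set (take i zs) \<inter> set (drop i zs) = {}"
      using assms by (simp add: set_take_disj_set_drop_if_distinct)
    then show "xs \<in> ?A"
      using assms i by (auto simp: remove1_append dest: in_set_takeD in_set_dropD)
  qed
  moreover have "inj_on ?ins {..length zs}"
  proof (rule inj_on_inverseI)
    fix i assume "i \<in> {..length zs}"
    \<comment> \<open>The place of insertion is recovered as the length of the prefix before
      \<open>c\<close>.\<close>
    moreover have "takeWhile (\<lambda>d. d \<noteq> c) (?ins i) = take i zs"
      using assms by (subst takeWhile_append2) (auto dest: in_set_takeD)
    ultimately show "length (takeWhile (\<lambda>d. d \<noteq> c) (?ins i)) = i" by simp
  qed
  ultimately show ?thesis by (simp add: card_image)
qed

text \<open>Bringing a random card to the front of a uniform list of touched cards:
  each outcome of length \<open>k\<close> has \<open>k\<close> preimages, each of length \<open>k + 1\<close> has one.\<close>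
lemma bind_distinct_lists_to_front:
  assumes "n > 0" "k \<le> n"
  shows "bind_pmf (pmf_of_set (distinct_lists {1..n} k))
             (\<lambda>xs. map_pmf (\<lambda>c. c # remove1 c xs) (pmf_of_set {1..n}))
           = bind_pmf (bernoulli_pmf (real k / real n))
               (\<lambda>b. pmf_of_set (distinct_lists {1..n} (if b then k else Suc k)))"
proof (rule pmf_eqI)
  fix ys :: "nat list"
  let ?L = "distinct_lists {1..n}"
  have ne: "?L k \<noteq> {}" using card_distinct_lists_pos[OF assms(2)] by auto
  have fin: "finite (?L j)" for j by simp
  \<comment> \<open>\<open>N\<close> counts the pairs of a list and a selected card that lead to
    \<open>ys\<close>; all pairs are equally likely.\<close>
  define N where "N = (\<Sum>xs\<in>?L k. card {c \<in> {1..n}. c # remove1 c xs = ys})"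
  have lhs: "pmf (bind_pmf (pmf_of_set (?L k))
             (\<lambda>xs. map_pmf (\<lambda>c. c # remove1 c xs) (pmf_of_set {1..n}))) ys
      = real N / (real n * real (card (?L k)))"
  proof -
    have "pmf (map_pmf (\<lambda>c. c # remove1 c xs) (pmf_of_set {1..n})) ys
        = real (card {c \<in> {1..n}. c # remove1 c xs = ys}) / real n" for xs
      using assms(1) by (simp add: pmf_map measure_pmf_of_set vimage_def Int_def)
    then show ?thesis
      using ne by (simp add: pmf_bind integral_pmf_of_set N_def sum_divide_distrib mult.commute)
  qed
  have "real k / real n \<le> 1" using assms by simp
  then have rhs: "pmf (bind_pmf (bernoulli_pmf (real k / real n))
               (\<lambda>b. pmf_of_set (?L (if b then k else Suc k)))) ys
      = real k / real n * pmf (pmf_of_set (?L k)) ys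
        + (1 - real k / real n) * pmf (pmf_of_set (?L (Suc k))) ys"
    by (simp add: pmf_bind mult.commute)
  have mem: "c # remove1 c xs \<in> ?L (if c \<in> set xs then k else Suc k)"
    if "xs \<in> ?L k" "c \<in> {1..n}" for c xs
  proof (cases "c \<in> set xs")
    case True
    then have "length (remove1 c xs) = length xs - 1" "0 < length xs"
      by (auto simp: length_remove1)
    then show ?thesis using that True by (auto simp: distinct_lists_def)
  next
    case False
    then show ?thesis using that by (auto simp: distinct_lists_def remove1_idem)
  qed
  have N_Cons: "N = card {xs \<in> ?L k. remove1 c xs = zs}" if "ys = c # zs" "c \<in> {1..n}" for c zs
  proof -
    have "{d \<in> {1..n}. d # remove1 d xs = ys} = (if remove1 c xs = zs then {c} else {})" for xs
      using that by auto
    then have "N = (\<Sum>xs\<in>?L k. if remove1 c xs = zs then 1 else 0)"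
      unfolding N_def by (intro sum.cong) auto
    then show ?thesis by (simp add: sum.If_cases Int_def)
  qed
  \<comment> \<open>For \<open>k < n\<close> the factor \<open>(n - k) / n\<close> cancels against
    the growth of the number of lists. For \<open>k = n\<close> no list of length
    \<open>Suc k\<close> exists and \<open>pmf_of_set\<close> is unspecified, but its weight is
    0.\<close>
  have Suc_eq: "(1 - real k / real n) * pmf (pmf_of_set (?L (Suc k))) ys
      = (if ys \<in> ?L (Suc k) then 1 / (real n * real (card (?L k))) else 0)"
  proof (cases "k < n")
    case True
    then have "?L (Suc k) \<noteq> {}" using card_distinct_lists_pos[of "Suc k" n] by auto
    moreover have "1 - real k / real n = real (n - k) / real n"
      using True by (simp add: of_nat_diff field_simps)
    moreover have "real (n - k) \<noteq> 0" using True by simp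
    ultimately show ?thesis
      using card_distinct_lists_Suc[OF True] by (simp add: indicator_def del: of_nat_diff)
  next
    case False
    then have "k = n" using assms by simp
    moreover have "?L (Suc n) = {}"
    proof -
      have "length xs \<le> n" if "distinct xs" "set xs \<subseteq> {1..n}" for xs
        using card_mono[OF _ that(2)] distinct_card[OF that(1)] by simp
      then show ?thesis by (force simp: distinct_lists_def)
    qed
    ultimately show ?thesis using assms by simp
  qed
  consider "ys \<in> ?L k" | "ys \<in> ?L (Suc k)" | "ys \<notin> ?L k" "ys \<notin> ?L (Suc k)" by blast
  then have "real N = (if ys \<in> ?L k then real k else if ys \<in> ?L (Suc k) then 1 else 0)"
  proof cases
    case 1
    show ?thesis
    proof (cases ys)
      case Nil
      then show ?thesis using 1 by (auto simp: N_def distinct_lists_def)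
    next
      case (Cons c zs)
      then have cz: "distinct (c # zs)" "c \<in> {1..n}" "Suc (length zs) = k" "set zs \<subseteq> {1..n}"
        using 1 by (auto simp: distinct_lists_def)
      have "{xs \<in> ?L k. remove1 c xs = zs} = {xs. distinct xs \<and> c \<in> set xs \<and> remove1 c xs = zs}"
      proof (intro equalityI subsetI)
        fix xs assume "xs \<in> {xs \<in> ?L k. remove1 c xs = zs}"
        then have xs: "distinct xs" "length xs = k" "remove1 c xs = zs"
          by (auto simp: distinct_lists_def)
        then have "length (remove1 c xs) < length xs" using cz(3) by simp
        then have "c \<in> set xs" by (auto simp: length_remove1 split: if_splits)
        then show "xs \<in> {xs. distinct xs \<and> c \<in> set xs \<and> remove1 c xs = zs}"
          using xs by simp
      next
        fix xs assume "xs \<in> {xs. distinct xs \<and> c \<in> set xs \<and> remove1 c xs = zs}"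
        then have xs: "distinct xs" "c \<in> set xs" "remove1 c xs = zs" by auto
        then have "set zs = set xs - {c}" "length zs = length xs - 1" "length xs > 0"
          by (auto simp: length_remove1)
        then show "xs \<in> {xs \<in> ?L k. remove1 c xs = zs}"
          using cz xs by (auto simp: distinct_lists_def)
      qed
      then show ?thesis
        using N_Cons[OF Cons] cz card_remove1_preimage[OF cz(1)] 1 by simp
    qed
  next
    case 2
    then obtain c zs where cz: "ys = c # zs" "c \<in> {1..n}" "c \<notin> set zs" "zs \<in> ?L k"
      by (auto simp: distinct_lists_def length_Suc_conv)
    have "{xs \<in> ?L k. remove1 c xs = zs} = {zs}"
    proof (intro equalityI subsetI)
      fix xs assume "xs \<in> {xs \<in> ?L k. remove1 c xs = zs}"
      then have xs: "xs \<in> ?L k" "remove1 c xs = zs" by auto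
      then have "length (remove1 c xs) = length xs" using cz by (simp add: distinct_lists_def)
      moreover have "length (remove1 c xs) < length xs" if "c \<in> set xs"
        using that length_pos_if_in_set[OF that] by (simp add: length_remove1)
      ultimately have "c \<notin> set xs" by auto
      then show "xs \<in> {zs}" using xs by (simp add: remove1_idem)
    qed (use cz in \<open>simp add: remove1_idem\<close>)
    moreover have "ys \<notin> ?L k" using 2 by (auto simp: distinct_lists_def)
    ultimately show ?thesis using N_Cons[OF cz(1,2)] 2 by simp
  next
    case 3
    then have "{c \<in> {1..n}. c # remove1 c xs = ys} = {}" if "xs \<in> ?L k" for xs
      using mem[OF that] by (force split: if_splits)
    then have "N = 0" unfolding N_def by (intro sum.neutral) simp
    then show ?thesis using 3 by simp
  qed
  moreover have "ys \<notin> ?L (Suc k)" if "ys \<in> ?L k"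
    using that by (auto simp: distinct_lists_def)
  ultimately show "pmf (bind_pmf (pmf_of_set (?L k))
             (\<lambda>xs. map_pmf (\<lambda>c. c # remove1 c xs) (pmf_of_set {1..n}))) ys
      = pmf (bind_pmf (bernoulli_pmf (real k / real n))
               (\<lambda>b. pmf_of_set (?L (if b then k else Suc k)))) ys"
    unfolding lhs rhs Suc_eq using ne by (auto simp: fin)
qed

section \<open>The number of touched cards\<close>

text \<open>This is the coupon collector chain: a selection hits an already touched card with
  probability \<open>k / n\<close>.\<close>

primrec touched_pmf :: "nat \<Rightarrow> nat \<Rightarrow> nat pmf" where
  "touched_pmf n 0 = return_pmf 0"
| "touched_pmf n (Suc r) = bind_pmf (touched_pmf n r)
     (\<lambda>k. map_pmf (\<lambda>b. if b then k else Suc k) (bernoulli_pmf (real k / real n)))"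

text \<open>At \<open>k = n\<close> the Bernoulli parameter is 1, so the chain cannot leave
  \<open>{..n}\<close>. The finite support later makes every function integrable.\<close>

lemma set_pmf_touched:
  assumes "n > 0"
  shows "set_pmf (touched_pmf n r) \<subseteq> {..n}"
proof (induction r)
  case (Suc r)
  have le: "(if b then k else Suc k) \<le> n"
    if "k \<in> set_pmf (touched_pmf n r)" "b \<in> set_pmf (bernoulli_pmf (real k / real n))" for k b
  proof -
    have "k \<le> n" using that Suc by auto
    moreover have "b" if "k = n"
      using \<open>b \<in> _\<close> that assms by (cases b) (auto simp: set_pmf_iff)
    ultimately show ?thesis by (cases "k = n") auto
  qed
  show ?case
  proof
    fix j assume "j \<in> set_pmf (touched_pmf n (Suc r))"
    then obtain k b where "k \<in> set_pmf (touched_pmf n r)"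
        "b \<in> set_pmf (bernoulli_pmf (real k / real n))" "j = (if b then k else Suc k)"
      by (auto split del: if_split)
    then show "j \<in> {..n}" using le by blast
  qed
qed simp

text \<open>Given their number, the touched cards stay uniformly ordered: a shuffle moves a card to
  the front of their list, and averaging over uniform lists yields uniform lists of the old or the
  next length, with the transition probabilities of the chain.\<close>

lemma iterated_random_to_top_eq:
  assumes "n > 0"
  shows "iterated_random_to_top n r = bind_pmf (touched_pmf n r)
           (\<lambda>k. map_pmf (deck n) (pmf_of_set (distinct_lists {1..n} k)))"
proof (induction r)
  case 0
  have "distinct_lists {1..n} 0 = {[]}" by (auto simp: distinct_lists_def)
  then show ?case by (simp add: bind_return_pmf pmf_of_set_singleton deck_def del: upt_Suc)
next
  case (Suc r)
  let ?U = "\<lambda>k. pmf_of_set (distinct_lists {1..n} k)"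
  have step: "bind_pmf (map_pmf (deck n) (?U k)) (random_to_top n)
      = bind_pmf (map_pmf (\<lambda>b. if b then k else Suc k) (bernoulli_pmf (real k / real n)))
          (\<lambda>k. map_pmf (deck n) (?U k))"
    if k: "k \<in> set_pmf (touched_pmf n r)" for k
  proof -
    have kn: "k \<le> n" using k set_pmf_touched[OF assms] by auto
    then have U: "set_pmf (?U k) = distinct_lists {1..n} k"
      using card_distinct_lists_pos[OF kn] by (intro set_pmf_of_set) auto
    have sub: "set xs \<subseteq> {1..n}" if "xs \<in> set_pmf (?U k)" for xs
      using that unfolding U by (simp add: distinct_lists_def)
    have "bind_pmf (map_pmf (deck n) (?U k)) (random_to_top n)
        = bind_pmf (?U k) (\<lambda>xs. map_pmf (\<lambda>c. move_to_top c (deck n xs)) (pmf_of_set {1..n}))"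
      by (simp add: bind_map_pmf random_to_top_def)
    also have "\<dots> = bind_pmf (?U k)
        (\<lambda>xs. map_pmf (deck n) (map_pmf (\<lambda>c. c # remove1 c xs) (pmf_of_set {1..n})))"
      unfolding map_pmf_comp using assms
      by (intro bind_pmf_cong map_pmf_cong refl move_to_top_deck sub) simp_all
    also have "\<dots> = map_pmf (deck n) (bind_pmf (bernoulli_pmf (real k / real n))
               (\<lambda>b. ?U (if b then k else Suc k)))"
      unfolding map_bind_pmf[symmetric] bind_distinct_lists_to_front[OF assms kn] ..
    finally show ?thesis by (simp add: map_bind_pmf bind_map_pmf)
  qed
  show ?case
    unfolding iterated_random_to_top.simps touched_pmf.simps Suc bind_assoc_pmf
    by (intro bind_pmf_cong refl step)
qed

section \<open>Mean-square concentration of the fraction of touched cards\<close>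

lemma integrable_touched:
  fixes f :: "nat \<Rightarrow> real"
  assumes "n > 0"
  shows "integrable (touched_pmf n r) f"
  by (rule integrable_measure_pmf_finite) (rule finite_subset[OF set_pmf_touched[OF assms]], simp)

lemma expectation_touched_Suc:
  fixes f :: "nat \<Rightarrow> real"
  assumes "n > 0"
  shows "measure_pmf.expectation (touched_pmf n (Suc r)) f
           = measure_pmf.expectation (touched_pmf n r)
               (\<lambda>k. real k / real n * f k + (1 - real k / real n) * f (Suc k))"
proof -
  have "measure_pmf.expectation (touched_pmf n (Suc r)) f
      = (\<Sum>k\<le>n. pmf (touched_pmf n r) k *\<^sub>R
           measure_pmf.expectation (map_pmf (\<lambda>b. if b then k else Suc k) (bernoulli_pmf (real k / real n))) f)"
    using set_pmf_touched[OF assms] unfolding touched_pmf.simps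
    by (intro pmf_expectation_bind) auto
  also have "\<dots> = (\<Sum>k\<le>n. pmf (touched_pmf n r) k *\<^sub>R
           (real k / real n * f k + (1 - real k / real n) * f (Suc k)))"
    using assms by (intro sum.cong) (auto simp: mult.commute)
  also have "\<dots> = measure_pmf.expectation (touched_pmf n r)
               (\<lambda>k. real k / real n * f k + (1 - real k / real n) * f (Suc k))"
    using set_pmf_touched[OF assms] by (intro integral_measure_pmf[symmetric]) auto
  finally show ?thesis .
qed

text \<open>The number of untouched cards is an eigenfunction of the transition operator: a given
  card escapes a selection with probability 1 - 1/n.\<close>

lemma expectation_untouched:
  assumes "n > 0"
  shows "measure_pmf.expectation (touched_pmf n r) (\<lambda>k. real n - real k)
           = real n * (1 - 1 / real n) ^ r"
proof (induction r)
  case (Suc r)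
  have "real k / real n * (real n - real k) + (1 - real k / real n) * (real n - real (Suc k))
      = (1 - 1 / real n) * (real n - real k)" for k
    using assms by (simp add: field_simps)
  then show ?case
    by (simp add: expectation_touched_Suc[OF assms] Suc del: touched_pmf.simps)
qed simp

text \<open>Again an eigenfunction, now for ordered pairs of untouched cards, with eigenvalue 1 -
  2/n.\<close>

lemma expectation_untouched_pairs:
  assumes "n > 0"
  shows "measure_pmf.expectation (touched_pmf n r) (\<lambda>k. (real n - real k) * (real n - real k - 1))
           = real n * (real n - 1) * (1 - 2 / real n) ^ r"
proof (induction r)
  case (Suc r)
  have "real k / real n * ((real n - real k) * (real n - real k - 1))
      + (1 - real k / real n) * ((real n - real (Suc k)) * (real n - real (Suc k) - 1))
      = (1 - 2 / real n) * ((real n - real k) * (real n - real k - 1))" for k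
    using assms by (simp add: field_simps)
  then show ?case
    by (simp add: expectation_touched_Suc[OF assms] Suc del: touched_pmf.simps)
qed simp

text \<open>The square is expanded in the two eigenfunctions and a constant; \<open>L\<close> stands
  for the expected limit of the untouched fraction.\<close>

lemma expectation_touched_deviation:
  assumes "n > 0"
  shows "measure_pmf.expectation (touched_pmf n r) (\<lambda>k. (real k / real n - (1 - L))\<^sup>2)
           = (1 - 1 / real n) * (1 - 2 / real n) ^ r
             + (1 / real n - 2 * L) * (1 - 1 / real n) ^ r + L\<^sup>2"
proof -
  have "(real k / real n - (1 - L))\<^sup>2
      = (1 / (real n)\<^sup>2) * ((real n - real k) * (real n - real k - 1))
        + ((1 / real n - 2 * L) / real n) * (real n - real k) + L\<^sup>2" for k
  proof -
    \<comment> \<open>In terms of the untouched fraction \<open>u\<close>, the square is (u - L)^2 =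
      u (u - 1/n) + (1/n - 2 L) u + L^2.\<close>
    define u where "u = (real n - real k) / real n"
    have u: "real n - real k = real n * u" "real k / real n = 1 - u"
      using assms by (simp_all add: u_def field_simps)
    have "(1 / (real n)\<^sup>2) * ((real n * u) * (real n * u - 1)) = u * (u - 1 / real n)"
      using assms by (simp add: field_simps power2_eq_square)
    moreover have "((1 / real n - 2 * L) / real n) * (real n * u) = (1 / real n - 2 * L) * u"
      using assms by simp
    ultimately show ?thesis
      unfolding u by (simp add: power2_eq_square algebra_simps)
  qed
  then have "measure_pmf.expectation (touched_pmf n r) (\<lambda>k. (real k / real n - (1 - L))\<^sup>2)
      = (1 / (real n)\<^sup>2) * (real n * (real n - 1) * (1 - 2 / real n) ^ r)
        + ((1 / real n - 2 * L) / real n) * (real n * (1 - 1 / real n) ^ r) + L\<^sup>2"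
    using assms
    by (simp only: Bochner_Integration.integral_add integrable_touched integral_mult_right_zero
        expectation_untouched expectation_untouched_pairs) simp
  also have "(1 / (real n)\<^sup>2) * (real n * (real n - 1) * (1 - 2 / real n) ^ r)
      = (1 - 1 / real n) * (1 - 2 / real n) ^ r"
    using assms by (simp add: field_simps power2_eq_square)
  also have "((1 / real n - 2 * L) / real n) * (real n * (1 - 1 / real n) ^ r)
      = (1 / real n - 2 * L) * (1 - 1 / real n) ^ r"
    using assms by simp
  finally show ?thesis .
qed

text \<open>The limit is L^2 - 2 L^2 + L^2 = 0, because the pair moment tends to the square of the
  single one.\<close>

lemma expectation_touched_deviation_tendsto:
  assumes L1: "(\<lambda>n. (1 - 1 / real n) ^ r n) \<longlonglongrightarrow> L"
    and L2: "(\<lambda>n. (1 - 2 / real n) ^ r n) \<longlonglongrightarrow> L\<^sup>2"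
  shows "(\<lambda>n. measure_pmf.expectation (touched_pmf n (r n))
            (\<lambda>k. (real k / real n - (1 - L))\<^sup>2)) \<longlonglongrightarrow> 0"
proof -
  have inv: "(\<lambda>n. 1 / real n) \<longlonglongrightarrow> 0" by (rule lim_1_over_n)
  have "(\<lambda>n. (1 - 1 / real n) * (1 - 2 / real n) ^ r n
             + (1 / real n - 2 * L) * (1 - 1 / real n) ^ r n + L\<^sup>2)
        \<longlonglongrightarrow> (1 - 0) * L\<^sup>2 + (0 - 2 * L) * L + L\<^sup>2"
    by (intro tendsto_intros inv L1 L2)
  then have "(\<lambda>n. (1 - 1 / real n) * (1 - 2 / real n) ^ r n
             + (1 / real n - 2 * L) * (1 - 1 / real n) ^ r n + L\<^sup>2) \<longlonglongrightarrow> 0"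
    by (simp add: power2_eq_square)
  moreover have "\<forall>\<^sub>F n in sequentially. (1 - 1 / real n) * (1 - 2 / real n) ^ r n
             + (1 / real n - 2 * L) * (1 - 1 / real n) ^ r n + L\<^sup>2
      = measure_pmf.expectation (touched_pmf n (r n)) (\<lambda>k. (real k / real n - (1 - L))\<^sup>2)"
    using eventually_gt_at_top[of 0] by eventually_elim (simp add: expectation_touched_deviation)
  ultimately show ?thesis by (rule Lim_transform_eventually)
qed

section \<open>Asymptotics of the powers (1 - a/n)^r\<close>

text \<open>The ratio \<open>r / n\<close> is isolated in the exponent, so that both regimes rest on
  the limit of n ln (1 - a/n).\<close>

lemma one_minus_over_eq_exp:
  assumes "real n > a" "a \<ge> 0"
  shows "(1 - a / real n) ^ r = exp (real r / real n * (real n * ln (1 - a / real n)))"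
proof -
  have "1 - a / real n > 0" using assms by simp
  then show ?thesis using assms by (simp add: exp_of_nat_mult)
qed

lemma n_ln_one_minus_tendsto:
  "(\<lambda>n. real n * ln (1 - a / real n)) \<longlonglongrightarrow> - a"
  by real_asymp

lemma one_minus_over_power_tendsto:
  assumes "a > 0" and r: "(\<lambda>n. real (r n) / real n) \<longlonglongrightarrow> c"
  shows "(\<lambda>n. (1 - a / real n) ^ r n) \<longlonglongrightarrow> exp (- a * c)"
proof (rule Lim_transform_eventually)
  show "(\<lambda>n. exp (real (r n) / real n * (real n * ln (1 - a / real n)))) \<longlonglongrightarrow> exp (- a * c)"
    using tendsto_exp[OF tendsto_mult[OF r n_ln_one_minus_tendsto[of a]]] by (simp add: mult.commute)
  show "\<forall>\<^sub>F n in sequentially. exp (real (r n) / real n * (real n * ln (1 - a / real n)))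
      = (1 - a / real n) ^ r n"
    using filterlim_real_sequentially[unfolded filterlim_at_top_dense, rule_format, of a] assms(1)
    by (auto elim!: eventually_mono simp: one_minus_over_eq_exp)
qed

lemma one_minus_over_power_tendsto_0:
  assumes "a > 0" and r: "filterlim (\<lambda>n. real (r n) / real n) at_top sequentially"
  shows "(\<lambda>n. (1 - a / real n) ^ r n) \<longlonglongrightarrow> 0"
proof (rule Lim_transform_eventually)
  have "filterlim (\<lambda>n. real n * ln (1 - a / real n) * (real (r n) / real n)) at_bot sequentially"
    using filterlim_tendsto_neg_mult_at_bot[OF n_ln_one_minus_tendsto[of a] _ r] assms(1) by simp
  then show "(\<lambda>n. exp (real (r n) / real n * (real n * ln (1 - a / real n)))) \<longlonglongrightarrow> 0"
    by (intro filterlim_compose[OF exp_at_bot]) (simp add: mult.commute)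
  show "\<forall>\<^sub>F n in sequentially. exp (real (r n) / real n * (real n * ln (1 - a / real n)))
      = (1 - a / real n) ^ r n"
    using filterlim_real_sequentially[unfolded filterlim_at_top_dense, rule_format, of a] assms(1)
    by (auto elim!: eventually_mono simp: one_minus_over_eq_exp)
qed

section \<open>Limit laws\<close>

text \<open>Inclusion-exclusion: the product of binomials equals
  \<open>(X choose x) * (X - x choose i)\<close>, and the alternating row sum vanishes unless
  \<open>X = x\<close>. Terms with \<open>i > X - x\<close> are 0, so any upper bound
  \<open>B\<close> may end the sum.\<close>

lemma indicator_eq_alternating_binomial_sum:
  assumes "X \<le> B"
  shows "(\<Sum>i\<le>B. (- 1) ^ i * real (x + i choose x) * real (X choose (x + i)))
           = (if X = x then 1 else 0)"
proof (cases "x \<le> X")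
  case False
  then show ?thesis by (auto simp: binomial_eq_0 intro!: sum.neutral)
next
  case True
  have eq: "real (x + i choose x) * real (X choose (x + i)) = real (X choose x) * real (X - x choose i)"
    if "i \<le> X - x" for i
  proof -
    have "(X choose (x + i)) * (x + i choose x) = (X choose x) * (X - x choose (x + i - x))"
      using that True by (intro choose_mult) auto
    then have "real ((X choose (x + i)) * (x + i choose x)) = real ((X choose x) * (X - x choose i))"
      by simp
    then show ?thesis by (simp add: mult.commute)
  qed
  have "(\<Sum>i\<le>B. (- 1) ^ i * real (x + i choose x) * real (X choose (x + i)))
      = (\<Sum>i\<le>X - x. (- 1) ^ i * real (x + i choose x) * real (X choose (x + i)))"
    using assms by (intro sum.mono_neutral_right) (auto simp: binomial_eq_0)
  also have "\<dots> = (\<Sum>i\<le>X - x. real (X choose x) * ((- 1) ^ i * real (X - x choose i)))"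
    using eq by (intro sum.cong) (auto simp: mult_ac)
  also have "\<dots> = real (X choose x) * (\<Sum>i\<le>X - x. (- 1) ^ i * real (X - x choose i))"
    by (rule sum_distrib_left[symmetric])
  also have "\<dots> = (if X = x then 1 else 0)"
    using True choose_alternating_sum[of "X - x", where 'a=real] by (cases "X = x") auto
  finally show ?thesis .
qed

text \<open>Exact in \<open>matches\<close> but a tail in \<open>gap\<close>, since tails are what
  the joint moments control; point masses follow by differencing.\<close>

definition joint_prob :: "nat \<Rightarrow> nat \<Rightarrow> nat \<Rightarrow> nat \<Rightarrow> real" where
  "joint_prob n k x j =
     real (card {xs \<in> distinct_lists {1..n} k. matches xs = x \<and> j \<le> gap n xs})
       / real (card (distinct_lists {1..n} k))"

text \<open>The indicator of \<open>matches xs = x\<close> is expanded by inclusion-exclusion and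
  averaged. Terms with \<open>i > k\<close> vanish, so the sum is written as a series whose range
  does not depend on \<open>k\<close>.\<close>

lemma joint_prob_eq_suminf:
  assumes "k \<le> n"
  shows "joint_prob n k x j
           = (\<Sum>i. (- 1) ^ i * real (x + i choose x) * joint_moment n k (x + i) j)"
proof -
  let ?L = "distinct_lists {1..n} k"
  let ?T = "{xs \<in> ?L. j \<le> gap n xs}"
  have le: "matches xs \<le> k" if "xs \<in> ?T" for xs
    using matches_le_length[of xs] that by (auto simp: distinct_lists_def)
  have "real (card {xs \<in> ?L. matches xs = x \<and> j \<le> gap n xs})
      = (\<Sum>xs\<in>?T. if matches xs = x then 1 else 0)"
    by (simp add: sum.If_cases Int_def conj_ac)
  also have "\<dots> = (\<Sum>xs\<in>?T. \<Sum>i\<le>k. (- 1) ^ i * real (x + i choose x) * real (matches xs choose (x + i)))"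
    by (intro sum.cong refl indicator_eq_alternating_binomial_sum[symmetric] le)
  also have "\<dots> = (\<Sum>i\<le>k. (- 1) ^ i * real (x + i choose x) * real (\<Sum>xs\<in>?T. matches xs choose (x + i)))"
    by (subst sum.swap) (simp add: sum_distrib_left)
  finally have "joint_prob n k x j
      = (\<Sum>i\<le>k. (- 1) ^ i * real (x + i choose x)
           * (real (\<Sum>xs\<in>?T. matches xs choose (x + i)) / real (card ?L)))"
    unfolding joint_prob_def by (simp add: sum_divide_distrib del: of_nat_sum)
  also have "\<dots> = (\<Sum>i\<le>k. (- 1) ^ i * real (x + i choose x) * joint_moment n k (x + i) j)"
    unfolding sum_matches_choose_gap[OF assms] ..
  also have "\<dots> = (\<Sum>i. (- 1) ^ i * real (x + i choose x) * joint_moment n k (x + i) j)"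
    by (rule suminf_finite[symmetric]) (auto simp: joint_moment_def binomial_eq_0)
  finally show ?thesis .
qed

section \<open>Limits of the joint moments and joint probabilities\<close>

text \<open>Up to m!, the quotient is a product of \<open>m\<close> factors N/n - i/n, each tending
  to \<rho>. The filter is left general so that pairs \<open>(n, k)\<close> can later vary
  jointly.\<close>

lemma binomial_over_power_tendsto:
  fixes N n :: "'a \<Rightarrow> nat"
  assumes n: "filterlim n at_top F" and N: "((\<lambda>a. real (N a) / real (n a)) \<longlongrightarrow> \<rho>) F"
  shows "((\<lambda>a. real (N a choose m) / real (n a) ^ m) \<longlongrightarrow> \<rho> ^ m / fact m) F"
proof -
  have eq: "real (N a choose m) / real (n a) ^ m
      = (\<Prod>i<m. real (N a) / real (n a) - real i / real (n a)) / fact m" for a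
    by (simp add: binomial_gbinomial gbinomial_prod_rev diff_divide_distrib[symmetric]
        prod_dividef atLeast0LessThan)
  have "((\<lambda>a. real i / real (n a)) \<longlongrightarrow> 0) F" for i
    by (rule real_tendsto_divide_at_top[OF tendsto_const])
      (rule filterlim_compose[OF filterlim_real_sequentially n])
  then have "((\<lambda>a. (\<Prod>i<m. real (N a) / real (n a) - real i / real (n a)) / fact m)
      \<longlongrightarrow> (\<Prod>i<m. \<rho> - 0) / fact m) F"
    by (intro tendsto_intros N) auto
  then show ?thesis unfolding eq by simp
qed

text \<open>Numerator and denominator are divided by n^(m + j), and each of the three binomials
  converges separately.\<close>

lemma joint_moment_tendsto:
  fixes k n :: "'a \<Rightarrow> nat"
  assumes n: "filterlim n at_top F" and k: "((\<lambda>a. real (k a) / real (n a)) \<longlongrightarrow> \<rho>) F"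
    and le: "\<forall>\<^sub>F a in F. k a \<le> n a"
  shows "((\<lambda>a. joint_moment (n a) (k a) m j) \<longlongrightarrow> \<rho> ^ m / fact m * (1 - \<rho>) ^ j) F"
proof (rule Lim_transform_eventually)
  have pos: "\<forall>\<^sub>F a in F. n a > 0"
    by (rule eventually_compose_filterlim[OF eventually_gt_at_top n])
  have self: "((\<lambda>a. real (n a) / real (n a)) \<longlongrightarrow> 1) F"
    by (rule Lim_transform_eventually[OF tendsto_const]) (use pos in eventually_elim, simp)
  have rest: "((\<lambda>a. real (n a - k a) / real (n a)) \<longlongrightarrow> 1 - \<rho>) F"
  proof (rule Lim_transform_eventually)
    show "((\<lambda>a. 1 - real (k a) / real (n a)) \<longlongrightarrow> 1 - \<rho>) F"
      by (intro tendsto_intros k)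
    show "\<forall>\<^sub>F a in F. 1 - real (k a) / real (n a) = real (n a - k a) / real (n a)"
      using pos le by eventually_elim (simp add: of_nat_diff field_simps)
  qed
  have "((\<lambda>a. (real (k a choose m) / real (n a) ^ m) * (real (n a - k a choose j) / real (n a) ^ j)
            * fact j / (real (n a choose (m + j)) / real (n a) ^ (m + j) * fact (m + j)))
      \<longlongrightarrow> (\<rho> ^ m / fact m) * ((1 - \<rho>) ^ j / fact j) * fact j
            / (1 ^ (m + j) / fact (m + j) * fact (m + j))) F"
    by (rule tendsto_divide[OF tendsto_mult[OF tendsto_mult[OF binomial_over_power_tendsto[OF n k]
              binomial_over_power_tendsto[OF n rest]] tendsto_const]
          tendsto_mult[OF binomial_over_power_tendsto[OF n self] tendsto_const]]) simp
  then show "((\<lambda>a. (real (k a choose m) / real (n a) ^ m) * (real (n a - k a choose j) / real (n a) ^ j)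
            * fact j / (real (n a choose (m + j)) / real (n a) ^ (m + j) * fact (m + j)))
      \<longlongrightarrow> \<rho> ^ m / fact m * (1 - \<rho>) ^ j) F"
    by simp
  show "\<forall>\<^sub>F a in F. (real (k a choose m) / real (n a) ^ m) * (real (n a - k a choose j) / real (n a) ^ j)
            * fact j / (real (n a choose (m + j)) / real (n a) ^ (m + j) * fact (m + j))
      = joint_moment (n a) (k a) m j"
    using pos by eventually_elim (simp add: joint_moment_def power_add)
qed

lemma binomial_over_fact: "real (x + i choose x) / fact (x + i) = 1 / (fact x * fact i)"
  by (subst binomial_fact) auto

text \<open>Tannery's theorem applies because the moments are bounded by \<open>1 / m!\<close>.\<close>
lemma joint_prob_tendsto:
  fixes k n :: "'a \<Rightarrow> nat"
  assumes n: "filterlim n at_top F" and k: "((\<lambda>a. real (k a) / real (n a)) \<longlongrightarrow> \<rho>) F"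
    and le: "\<forall>\<^sub>F a in F. k a \<le> n a"
  shows "((\<lambda>a. joint_prob (n a) (k a) x j) \<longlongrightarrow> \<rho> ^ x / fact x * exp (- \<rho>) * (1 - \<rho>) ^ j) F"
\<comment> \<open>Tannery's theorem is applied to a proper filter; for \<open>bot\<close> every
  limit is trivial.\<close>
proof (cases "F = bot")
  case False
  let ?f = "\<lambda>i a. (- 1) ^ i * real (x + i choose x) * joint_moment (n a) (k a) (x + i) j"
  let ?g = "\<lambda>i. (- 1) ^ i * real (x + i choose x) * (\<rho> ^ (x + i) / fact (x + i) * (1 - \<rho>) ^ j)"
  have "((\<lambda>a. \<Sum>i. ?f i a) \<longlongrightarrow> (\<Sum>i. ?g i)) F"
  proof (rule tannerys_theorem[THEN conjunct2, THEN conjunct2])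
    show "((\<lambda>a. ?f i a) \<longlongrightarrow> ?g i) F" for i
      by (intro tendsto_intros joint_moment_tendsto n k le)
    have bound: "norm (?f i a) \<le> 1 / (fact x * fact i)" if "k a \<le> n a" for i a
    proof -
      have "norm (?f i a) = real (x + i choose x) * joint_moment (n a) (k a) (x + i) j"
        by (simp add: abs_mult joint_moment_nonneg)
      also have "\<dots> \<le> real (x + i choose x) * (1 / fact (x + i))"
        by (intro mult_left_mono joint_moment_le that) auto
      finally show ?thesis using binomial_over_fact[of x i] by simp
    qed
    show "\<forall>\<^sub>F (i, a) in at_top \<times>\<^sub>F F. norm (?f i a) \<le> 1 / (fact x * fact i)"
      unfolding eventually_prod_filter
      by (rule exI[of _ "\<lambda>_. True"], rule exI[of _ "\<lambda>a. k a \<le> n a"]) (use le bound in auto)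
    have "summable (\<lambda>i. 1 / fact x * (inverse (fact i) * (1::real) ^ i))"
      by (intro summable_mult summable_exp)
    then show "summable (\<lambda>i. 1 / (fact x * fact i) :: real)"
      by (simp add: field_simps)
  qed (rule False)
  moreover have "(\<Sum>i. ?g i) = \<rho> ^ x / fact x * exp (- \<rho>) * (1 - \<rho>) ^ j"
  proof -
    \<comment> \<open>What depends on \<open>i\<close> is the exponential series at -
      \<rho>.\<close>
    have "?g i = \<rho> ^ x / fact x * (1 - \<rho>) ^ j * ((- \<rho>) ^ i /\<^sub>R fact i)" for i
    proof -
      have "?g i = (real (x + i choose x) / fact (x + i)) * ((- 1) ^ i * \<rho> ^ i) * \<rho> ^ x * (1 - \<rho>) ^ j"
        by (simp add: power_add)
      also have "(- 1) ^ i * \<rho> ^ i = (- \<rho>) ^ i"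
        by (simp add: power_mult_distrib[symmetric])
      finally show ?thesis unfolding binomial_over_fact by (simp add: field_simps)
    qed
    then have "?g sums (\<rho> ^ x / fact x * (1 - \<rho>) ^ j * exp (- \<rho>))"
      using sums_mult[OF exp_converges[of "- \<rho>"], of "\<rho> ^ x / fact x * (1 - \<rho>) ^ j"] by simp
    then show ?thesis by (simp add: sums_iff mult_ac)
  qed
  moreover have "\<forall>\<^sub>F a in F. (\<Sum>i. ?f i a) = joint_prob (n a) (k a) x j"
    using le by eventually_elim (simp add: joint_prob_eq_suminf)
  ultimately show ?thesis by (auto intro: Lim_transform_eventually)
qed simp

section \<open>From the conditional law to the law of the fixed points\<close>

definition fixed_points_given_touched :: "nat \<Rightarrow> nat \<Rightarrow> nat pmf" where
  "fixed_points_given_touched n k =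
     map_pmf (\<lambda>xs. num_fixed_points (deck n xs)) (pmf_of_set (distinct_lists {1..n} k))"

text \<open>A total of \<open>z\<close> splits by the number \<open>x\<close> of matches, which
  leaves a gap of exactly \<open>z - x\<close>: a difference of two consecutive tails.\<close>

lemma pmf_fixed_points_given_touched:
  assumes "k \<le> n"
  shows "pmf (fixed_points_given_touched n k) z
           = (\<Sum>x\<le>z. joint_prob n k x (z - x) - joint_prob n k x (Suc (z - x)))"
proof -
  let ?L = "distinct_lists {1..n} k"
  let ?A = "\<lambda>x j. {xs \<in> ?L. matches xs = x \<and> j \<le> gap n xs}"
  have ne: "?L \<noteq> {}" using card_distinct_lists_pos[OF assms] by auto
  have fin: "finite ?L" by simp
  have "?L \<inter> {xs. num_fixed_points (deck n xs) = z} = (\<Union>x\<le>z. ?A x (z - x) - ?A x (Suc (z - x)))"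
  proof (rule set_eqI)
    fix xs
    have "num_fixed_points (deck n xs) = matches xs + gap n xs" if "xs \<in> ?L"
      using that by (rule num_fixed_points_deck)
    moreover have "m + g = z \<longleftrightarrow> m \<le> z \<and> z - m \<le> g \<and> \<not> Suc (z - m) \<le> g" for m g
      by auto
    ultimately show "xs \<in> ?L \<inter> {xs. num_fixed_points (deck n xs) = z}
        \<longleftrightarrow> xs \<in> (\<Union>x\<le>z. ?A x (z - x) - ?A x (Suc (z - x)))"
      by auto
  qed
  then have card_eq: "card (?L \<inter> {xs. num_fixed_points (deck n xs) = z})
      = (\<Sum>x\<le>z. card (?A x (z - x) - ?A x (Suc (z - x))))"
    by (simp only:) (rule card_UN_disjoint, auto)
  have card: "real (card (?L \<inter> {xs. num_fixed_points (deck n xs) = z}))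
      = (\<Sum>x\<le>z. real (card (?A x (z - x))) - real (card (?A x (Suc (z - x)))))"
    unfolding card_eq of_nat_sum
  proof (rule sum.cong)
    fix x
    have sub: "?A x (Suc (z - x)) \<subseteq> ?A x (z - x)" by auto
    have fin': "finite (?A x (z - x))" using fin by simp
    show "real (card (?A x (z - x) - ?A x (Suc (z - x))))
        = real (card (?A x (z - x))) - real (card (?A x (Suc (z - x))))"
      using card_Diff_subset[OF finite_subset[OF sub fin'] sub] card_mono[OF fin' sub]
      by (simp only: of_nat_diff)
  qed simp
  have "pmf (fixed_points_given_touched n k) z
      = real (card (?L \<inter> {xs. num_fixed_points (deck n xs) = z})) / real (card ?L)"
    using ne fin
    by (simp add: fixed_points_given_touched_def pmf_map measure_pmf_of_set vimage_def)
  then show ?thesis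
    unfolding card joint_prob_def by (simp only: sum_divide_distrib diff_divide_distrib)
qed

lemma pmf_add_pair_pmf:
  fixes p q :: "nat pmf"
  shows "pmf (map_pmf (\<lambda>(x, y). x + y) (pair_pmf p q)) z = (\<Sum>x\<le>z. pmf p x * pmf q (z - x))"
proof -
  have "(\<lambda>(x, y). x + y) -` {z} = (\<lambda>x. (x, z - x)) ` {..z}"
    by (auto simp: image_iff)
  then have "pmf (map_pmf (\<lambda>(x, y). x + y) (pair_pmf p q)) z
      = (\<Sum>w\<in>(\<lambda>x. (x, z - x)) ` {..z}. pmf (pair_pmf p q) w)"
    by (simp add: pmf_map measure_measure_pmf_finite)
  also have "\<dots> = (\<Sum>x\<le>z. pmf p x * pmf q (z - x))"
    by (subst sum.reindex) (auto simp: inj_on_def pmf_pair)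
  finally show ?thesis .
qed

definition poisson_plus_geometric :: "real \<Rightarrow> nat pmf" where
  "poisson_plus_geometric \<rho> =
     map_pmf (\<lambda>(x, y). x + y) (pair_pmf (poisson_pmf \<rho>) (geometric_pmf \<rho>))"

lemma pmf_fixed_points_given_touched_tendsto:
  fixes k n :: "'a \<Rightarrow> nat"
  assumes n: "filterlim n at_top F" and k: "((\<lambda>a. real (k a) / real (n a)) \<longlongrightarrow> \<rho>) F"
    and le: "\<forall>\<^sub>F a in F. k a \<le> n a" and \<rho>: "0 < \<rho>" "\<rho> \<le> 1"
  shows "((\<lambda>a. pmf (fixed_points_given_touched (n a) (k a)) z)
           \<longlongrightarrow> pmf (poisson_plus_geometric \<rho>) z) F"
proof (rule Lim_transform_eventually)
  let ?h = "\<lambda>x j. \<rho> ^ x / fact x * exp (- \<rho>) * (1 - \<rho>) ^ j"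
  have "((\<lambda>a. \<Sum>x\<le>z. joint_prob (n a) (k a) x (z - x) - joint_prob (n a) (k a) x (Suc (z - x)))
      \<longlongrightarrow> (\<Sum>x\<le>z. ?h x (z - x) - ?h x (Suc (z - x)))) F"
    by (intro tendsto_intros joint_prob_tendsto n k le)
  \<comment> \<open>Differencing the tails (1 - \<rho>)^j gives \<rho> (1 - \<rho>)^j, the geometric
    point mass.\<close>
  also have "(\<Sum>x\<le>z. ?h x (z - x) - ?h x (Suc (z - x))) = pmf (poisson_plus_geometric \<rho>) z"
    using \<rho> by (simp add: poisson_plus_geometric_def pmf_add_pair_pmf algebra_simps)
  finally show "((\<lambda>a. \<Sum>x\<le>z. joint_prob (n a) (k a) x (z - x) - joint_prob (n a) (k a) x (Suc (z - x)))
      \<longlongrightarrow> pmf (poisson_plus_geometric \<rho>) z) F" .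
  show "\<forall>\<^sub>F a in F. (\<Sum>x\<le>z. joint_prob (n a) (k a) x (z - x) - joint_prob (n a) (k a) x (Suc (z - x)))
      = pmf (fixed_points_given_touched (n a) (k a)) z"
    using le by eventually_elim (simp add: pmf_fixed_points_given_touched)
qed

text \<open>Convergence along a filter of pairs \<open>(n, k)\<close> is unfolded into a bound
  uniform in \<open>k\<close>, as needed for averaging over a random \<open>k\<close>.\<close>

lemma pmf_fixed_points_given_touched_uniform:
  assumes \<rho>: "0 < \<rho>" "\<rho> \<le> 1" and "\<epsilon> > 0"
  obtains \<delta> N where "\<delta> > 0"
    "\<And>n k. n \<ge> N \<Longrightarrow> k \<le> n \<Longrightarrow> \<bar>real k / real n - \<rho>\<bar> < \<delta> \<Longrightarrow>
       \<bar>pmf (fixed_points_given_touched n k) z - pmf (poisson_plus_geometric \<rho>) z\<bar> < \<epsilon>"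
proof -
  \<comment> \<open>\<open>G\<close> is the coarsest filter along which \<open>n\<close> tends to
    infinity, \<open>k / n\<close> tends to \<rho>, and \<open>k \<le> n\<close>.\<close>
  define G where "G = inf (filtercomap fst sequentially)
    (inf (filtercomap (\<lambda>a. real (snd a) / real (fst a)) (nhds \<rho>)) (principal {a. snd a \<le> fst a}))"
  have "filterlim fst sequentially G"
    unfolding filterlim_iff_le_filtercomap G_def by simp
  moreover have "((\<lambda>a. real (snd a) / real (fst a)) \<longlongrightarrow> \<rho>) G"
    unfolding filterlim_iff_le_filtercomap G_def by (meson inf.cobounded1 inf.cobounded2 order_trans)
  moreover have "\<forall>\<^sub>F a in G. snd a \<le> fst a"
    unfolding G_def eventually_inf_principal inf_assoc[symmetric] by simp
  ultimately have "\<forall>\<^sub>F a in G. dist (pmf (fixed_points_given_touched (fst a) (snd a)) z)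
      (pmf (poisson_plus_geometric \<rho>) z) < \<epsilon>"
    using \<rho> \<open>\<epsilon> > 0\<close> by (intro tendstoD pmf_fixed_points_given_touched_tendsto)
  then have "\<forall>\<^sub>F a in inf (filtercomap fst sequentially) (filtercomap (\<lambda>a. real (snd a) / real (fst a)) (nhds \<rho>)).
      a \<in> {a. snd a \<le> fst a} \<longrightarrow> dist (pmf (fixed_points_given_touched (fst a) (snd a)) z)
      (pmf (poisson_plus_geometric \<rho>) z) < \<epsilon>"
    unfolding G_def inf_assoc[symmetric] eventually_inf_principal .
  then obtain P Q where PQ: "eventually P (filtercomap fst sequentially)"
      "eventually Q (filtercomap (\<lambda>a. real (snd a) / real (fst a)) (nhds \<rho>))"
      "\<And>a. P a \<Longrightarrow> Q a \<Longrightarrow> snd a \<le> fst a \<Longrightarrow> dist (pmf (fixed_points_given_touched (fst a) (snd a)) z)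
      (pmf (poisson_plus_geometric \<rho>) z) < \<epsilon>"
    unfolding eventually_inf by auto
  obtain N where N: "\<And>a. fst a \<ge> N \<Longrightarrow> P a"
    using PQ(1) unfolding eventually_filtercomap eventually_sequentially by blast
  obtain \<delta> where \<delta>: "\<delta> > 0" "\<And>a. dist (real (snd a) / real (fst a)) \<rho> < \<delta> \<Longrightarrow> Q a"
    using PQ(2) unfolding eventually_filtercomap eventually_nhds_metric by blast
  show ?thesis
  proof (rule that[OF \<delta>(1)])
    fix n k assume "n \<ge> N" "k \<le> n" "\<bar>real k / real n - \<rho>\<bar> < \<delta>"
    then show "\<bar>pmf (fixed_points_given_touched n k) z - pmf (poisson_plus_geometric \<rho>) z\<bar> < \<epsilon>"
      using PQ(3)[of "(n, k)"] N[of "(n, k)"] \<delta>(2)[of "(n, k)"] by (simp add: dist_real_def)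
  qed
qed

lemma pmf_fixed_points_eq:
  assumes "n > 0"
  shows "pmf (fixed_points_pmf r n) z
           = measure_pmf.expectation (touched_pmf n r) (\<lambda>k. pmf (fixed_points_given_touched n k) z)"
  unfolding fixed_points_pmf_def iterated_random_to_top_eq[OF assms]
  by (simp add: map_bind_pmf map_pmf_comp fixed_points_given_touched_def pmf_bind)

text \<open>A Chebyshev argument: the conditional probabilities are uniformly close to the limit
  when \<open>k / n\<close> is near \<rho>, and the mean-square deviation controls the remaining
  \<open>k\<close>.\<close>

lemma pmf_fixed_points_tendsto:
  assumes \<rho>: "0 < \<rho>" "\<rho> \<le> 1"
    and dev: "(\<lambda>n. measure_pmf.expectation (touched_pmf n (r n))
               (\<lambda>k. (real k / real n - \<rho>)\<^sup>2)) \<longlonglongrightarrow> 0"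
  shows "(\<lambda>n. pmf (fixed_points_pmf (r n) n) z) \<longlonglongrightarrow> pmf (poisson_plus_geometric \<rho>) z"
proof (rule tendstoI)
  fix \<epsilon> :: real assume "\<epsilon> > 0"
  let ?l = "pmf (poisson_plus_geometric \<rho>) z"
  let ?g = "\<lambda>n k. pmf (fixed_points_given_touched n k) z"
  obtain \<delta> N where \<delta>: "\<delta> > 0"
    "\<And>n k. n \<ge> N \<Longrightarrow> k \<le> n \<Longrightarrow> \<bar>real k / real n - \<rho>\<bar> < \<delta> \<Longrightarrow> \<bar>?g n k - ?l\<bar> < \<epsilon> / 2"
    using pmf_fixed_points_given_touched_uniform[OF \<rho>, of "\<epsilon> / 2" z] \<open>\<epsilon> > 0\<close> by auto
  \<comment> \<open>Away from \<rho> the quadratic term is at least 1 and so dominates any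
    difference of two probabilities.\<close>
  have bound: "\<bar>?g n k - ?l\<bar> \<le> \<epsilon> / 2 + (1 / \<delta>\<^sup>2) * (real k / real n - \<rho>)\<^sup>2" if "n \<ge> N" "k \<le> n" for n k
  proof (cases "\<bar>real k / real n - \<rho>\<bar> < \<delta>")
    case True
    then have "\<bar>?g n k - ?l\<bar> \<le> \<epsilon> / 2" using \<delta>(2) that by force
    then show ?thesis by (simp add: add_increasing2)
  next
    case False
    then have "\<delta>\<^sup>2 \<le> (real k / real n - \<rho>)\<^sup>2"
      using \<delta>(1) by (simp add: abs_le_square_iff[symmetric])
    then have "1 \<le> (1 / \<delta>\<^sup>2) * (real k / real n - \<rho>)\<^sup>2" using \<delta>(1) by (simp add: field_simps)
    moreover have "\<bar>?g n k - ?l\<bar> \<le> 1"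
      using pmf_nonneg[of "fixed_points_given_touched n k" z] pmf_le_1[of "fixed_points_given_touched n k" z]
        pmf_nonneg[of "poisson_plus_geometric \<rho>" z] pmf_le_1[of "poisson_plus_geometric \<rho>" z]
      by linarith
    ultimately show ?thesis using \<open>\<epsilon> > 0\<close> by linarith
  qed
  \<comment> \<open>The threshold becomes \<open>\<epsilon> / 2\<close> after division by the square
    of \<delta>.\<close>
  have "\<forall>\<^sub>F n in sequentially. measure_pmf.expectation (touched_pmf n (r n))
      (\<lambda>k. (real k / real n - \<rho>)\<^sup>2) < \<epsilon> / 2 * \<delta>\<^sup>2"
    using \<delta>(1) \<open>\<epsilon> > 0\<close> by (intro order_tendstoD(2)[OF dev]) simp
  moreover have "\<forall>\<^sub>F n in sequentially. n \<ge> N" by (rule eventually_ge_at_top)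
  moreover have "\<forall>\<^sub>F n in sequentially. n > (0::nat)" by (rule eventually_gt_at_top)
  ultimately show "\<forall>\<^sub>F n in sequentially. dist (pmf (fixed_points_pmf (r n) n) z) ?l < \<epsilon>"
  proof eventually_elim
    case (elim n)
    let ?E = "measure_pmf.expectation (touched_pmf n (r n))"
    note int = integrable_touched[OF elim(3)]
    have "\<bar>pmf (fixed_points_pmf (r n) n) z - ?l\<bar> = \<bar>?E (\<lambda>k. ?g n k - ?l)\<bar>"
      by (simp add: pmf_fixed_points_eq[OF elim(3)] int)
    also have "\<dots> \<le> ?E (\<lambda>k. \<bar>?g n k - ?l\<bar>)"
      by (rule integral_abs_bound)
    also have "\<dots> \<le> ?E (\<lambda>k. \<epsilon> / 2 + (1 / \<delta>\<^sup>2) * (real k / real n - \<rho>)\<^sup>2)"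
      using set_pmf_touched[OF elim(3)] bound[OF elim(2)]
      by (intro integral_mono_AE int AE_pmfI) auto
    also have "\<dots> = \<epsilon> / 2 + (1 / \<delta>\<^sup>2) * ?E (\<lambda>k. (real k / real n - \<rho>)\<^sup>2)"
      by (subst Bochner_Integration.integral_add) (simp_all add: int)
    also have "\<dots> < \<epsilon>"
      using elim(1) \<delta>(1) by (simp add: field_simps)
    finally show ?case by (simp add: dist_real_def)
  qed
qed

section \<open>Convergence in distribution\<close>

text \<open>For laws on the naturals, the distribution function at any real point is a finite sum of
  point masses.\<close>

lemma conv_in_distributionI:
  assumes "\<And>z. (\<lambda>n. pmf (P n) z) \<longlonglongrightarrow> pmf p z"
  shows "conv_in_distribution P p"
proof -
  have fin: "finite {z. real z \<le> x}" for x
    by (rule finite_subset[of _ "{..nat \<lfloor>x\<rfloor>}"]) (auto simp: le_nat_floor)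
  have "cdf (real_law q) x = (\<Sum>z | real z \<le> x. pmf q z)" for q x
    unfolding cdf_def real_law_def
    by (subst measure_distr) (auto simp: vimage_def measure_measure_pmf_finite[OF fin])
  then show ?thesis
    unfolding conv_in_distribution_def weak_conv_m_def weak_conv_def
    by (auto intro!: tendsto_sum assms)
qed

text \<open>Common to both regimes: \<open>L\<close> is the limiting fraction of untouched cards,
  and \<open>L < 1\<close> makes the geometric parameter positive.\<close>

lemma conv_in_distribution_fixed_points:
  assumes L: "0 \<le> L" "L < 1"
    and L1: "(\<lambda>n. (1 - 1 / real n) ^ r n) \<longlonglongrightarrow> L"
    and L2: "(\<lambda>n. (1 - 2 / real n) ^ r n) \<longlonglongrightarrow> L\<^sup>2"
  shows "conv_in_distribution (\<lambda>n. fixed_points_pmf (r n) n) (poisson_plus_geometric (1 - L))"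
  using L expectation_touched_deviation_tendsto[OF L1 L2]
  by (intro conv_in_distributionI pmf_fixed_points_tendsto) auto

theorem theorem1p1:
  shows "(\<forall>c::real. c > 0 \<longrightarrow>
            conv_in_distribution (\<lambda>n. fixed_points_pmf (nat \<lfloor>c * real n\<rfloor>) n)
              (map_pmf (\<lambda>(x, y). x + y)
                (pair_pmf (poisson_pmf (1 - exp (- c))) (geometric_pmf (1 - exp (- c))))))
       \<and> (\<forall>r::nat \<Rightarrow> nat. (\<forall>n\<ge>1. r n > 0) \<longrightarrow>
            filterlim (\<lambda>n. real (r n) / real n) at_top sequentially \<longrightarrow>
            conv_in_distribution (\<lambda>n. fixed_points_pmf (r n) n) (poisson_pmf 1))"
proof (intro conjI allI impI)
  fix c :: real assume c: "c > 0"
  have r: "(\<lambda>n. real (nat \<lfloor>c * real n\<rfloor>) / real n) \<longlonglongrightarrow> c"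
    using c by real_asymp
  have "conv_in_distribution (\<lambda>n. fixed_points_pmf (nat \<lfloor>c * real n\<rfloor>) n)
          (poisson_plus_geometric (1 - exp (- c)))"
    \<comment> \<open>The limit for a = 2 is exp (- 2 c), the square of the limit exp (- c) for a =
      1.\<close>
    using c one_minus_over_power_tendsto[OF _ r, of 1] one_minus_over_power_tendsto[OF _ r, of 2]
    by (intro conv_in_distribution_fixed_points) (simp_all flip: exp_double)
  then show "conv_in_distribution (\<lambda>n. fixed_points_pmf (nat \<lfloor>c * real n\<rfloor>) n)
          (map_pmf (\<lambda>(x, y). x + y)
            (pair_pmf (poisson_pmf (1 - exp (- c))) (geometric_pmf (1 - exp (- c)))))"
    by (simp add: poisson_plus_geometric_def)
next
  fix r :: "nat \<Rightarrow> nat"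
  assume r: "filterlim (\<lambda>n. real (r n) / real n) at_top sequentially"
  have "conv_in_distribution (\<lambda>n. fixed_points_pmf (r n) n) (poisson_plus_geometric (1 - 0))"
    using one_minus_over_power_tendsto_0[OF _ r, of 1] one_minus_over_power_tendsto_0[OF _ r, of 2]
    by (intro conv_in_distribution_fixed_points) simp_all
  \<comment> \<open>The geometric law with parameter 1 is the point mass at 0.\<close>
  moreover have "poisson_plus_geometric 1 = poisson_pmf 1"
    by (simp add: poisson_plus_geometric_def pair_return_pmf2 map_pmf_comp)
  ultimately show "conv_in_distribution (\<lambda>n. fixed_points_pmf (r n) n) (poisson_pmf 1)"
    by simp
qed

end
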